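(* Let $2 \le k \le r \le n$ be integers. Then every ordered $n$-vertex $r$-graph $H$ is the union of pairwise edge-disjoint ordered $r$-graphs $H_i$, $0 \le i \le \lfloor \log_2 n\rfloor$ (subgraphs of $H$ with the same vertex ordering), such that for each $i$ the $r$-graph $H_i$ is a union of at most $$\frac{1}{(k-1)!}\left(\sum_{j=k}^{r}\binom{2k-2}{j}\right) 2^{i(k-1)}$$ interval $k$-partite $r$-graphs with parts of size at most $\lceil n/2^i\rceil$.
   Context: An $r$-graph is a finite hypergraph all of whose edges have size $r$; hypergraphs are identified with their edge sets. An ordered $r$-graph is an $r$-graph together with a linear ordering of its vertex set $V$. An interval in $V$ is a set of consecutive elements in the ordering. For $A,B\subset V$, $A<B$ means $a<b$ for all $a\in A$, $b\in B$. An ordered $r$-graph $H$ is interval $k$-partite if for some $\ell\ge k$ there are intervals $I_1<I_2<\cdots<I_\ell$ of the vertex set such that every edge of $H$ is contained in $I_1\cup\dots\cup I_\ell$ and has nonempty intersection with $I_j$ for each $1\le j\le \ell$. The intervals $I_1,\dots,I_\ell$ are called the parts. Saying that an interval $k$-partite $r$-graph has parts of size at most $s$ means that such intervals can be chosen with $|I_j|\le s$ for all $j$. *)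

theory Defs
  imports Complex_Main "HOL-Library.Disjoint_Sets"
begin

text \<open>
  The vertex set of an ordered \<open>r\<close>-graph is a finite subset \<open>V\<close> of a linearly ordered type,
  ordered by the order of that type; a hypergraph is its set of edges.
\<close>

definition ordered_rgraph :: "nat \<Rightarrow> 'a::linorder set \<Rightarrow> 'a set set \<Rightarrow> bool" where
  "ordered_rgraph r V H \<longleftrightarrow> finite V \<and> (\<forall>e\<in>H. e \<subseteq> V \<and> card e = r)"

text \<open>Consecutive means consecutive within \<open>V\<close>, not within the ambient type.\<close>

definition interval_in :: "'a::linorder set \<Rightarrow> 'a set \<Rightarrow> bool" where
  "interval_in V I \<longleftrightarrow> I \<subseteq> V \<and> (\<forall>x\<in>I. \<forall>y\<in>I. \<forall>z\<in>V. x \<le> z \<and> z \<le> y \<longrightarrow> z \<in> I)"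

definition set_before :: "'a::linorder set \<Rightarrow> 'a set \<Rightarrow> bool" where
  "set_before A B \<longleftrightarrow> (\<forall>a\<in>A. \<forall>b\<in>B. a < b)"

definition interval_parts ::
    "'a::linorder set \<Rightarrow> 'a set set \<Rightarrow> nat \<Rightarrow> (nat \<Rightarrow> 'a set) \<Rightarrow> bool" where
  "interval_parts V G l I \<longleftrightarrow>
     (\<forall>j\<in>{1..l}. interval_in V (I j)) \<and>
     (\<forall>i\<in>{1..l}. \<forall>j\<in>{1..l}. i < j \<longrightarrow> set_before (I i) (I j)) \<and>
     (\<forall>e\<in>G. e \<subseteq> (\<Union>j\<in>{1..l}. I j) \<and> (\<forall>j\<in>{1..l}. e \<inter> I j \<noteq> {}))"

definition interval_partite_parts_le ::
    "nat \<Rightarrow> nat \<Rightarrow> int \<Rightarrow> 'a::linorder set \<Rightarrow> 'a set set \<Rightarrow> bool" where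
  "interval_partite_parts_le r k s V G \<longleftrightarrow>
     ordered_rgraph r V G \<and>
     (\<exists>l\<ge>k. \<exists>I. interval_parts V G l I \<and> (\<forall>j\<in>{1..l}. int (card (I j)) \<le> s))"

end

theory Submission
  imports Defs "HOL-Library.Log_Nat"
begin

text \<open>
  Cut \<open>V\<close> into \<open>2 ^ i\<close> nested dyadic blocks of size at most \<open>\<lceil>n / 2 ^ i\<rceil>\<close> for every \<open>i\<close>. Put an edge
  into \<open>H\<^sub>i\<close> if \<open>i + 1\<close> is the first level at which it meets at least \<open>k\<close> blocks, and split \<open>H\<^sub>i\<close>
  according to the set \<open>S\<close> of blocks of level \<open>i + 1\<close> that an edge meets. As the edge meets at most
  \<open>k - 1\<close> blocks of level \<open>i\<close>, the set \<open>S\<close> consists of \<open>j\<close> out of \<open>2 k - 2\<close> halves of \<open>k - 1\<close>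
  blocks, with \<open>k \<le> j \<le> r\<close>, and there are at most \<open>2 ^ (i (k - 1)) / (k - 1)!\<close> choices of these
  \<open>k - 1\<close> blocks. If there are fewer than \<open>k - 1\<close> blocks of level \<open>i\<close>, all sets \<open>S\<close> are counted
  instead, using \<open>K! \<le> ((K + 1) / 2) ^ K\<close>.
\<close>

subsection \<open>Counting sets with a small image\<close>

lemma two_power_mult_fact_le: "2 ^ n * fact n \<le> Suc n ^ n"
proof (induction n)
  case (Suc n)
  let ?N = "Suc n"
  have "2 \<le> (1 + 1 / real ?N) ^ ?N"
    using Bernoulli_inequality[of "1 / real ?N" ?N] by (simp add: order_trans[of "- 1" 0])
  then have "2 * real ?N ^ ?N \<le> (1 + 1 / real ?N) ^ ?N * real ?N ^ ?N"
    by (rule mult_right_mono) simp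
  also have "\<dots> = ((1 + 1 / real ?N) * real ?N) ^ ?N"
    by (simp only: power_mult_distrib)
  also have "(1 + 1 / real ?N) * real ?N = real (Suc ?N)"
    by (simp add: field_simps)
  finally have "real (2 * ?N ^ ?N) \<le> real (Suc ?N ^ ?N)"
    by (simp only: of_nat_mult of_nat_power of_nat_numeral)
  then have bernoulli: "2 * ?N ^ ?N \<le> Suc ?N ^ ?N"
    by (simp only: of_nat_le_iff)
  have "2 ^ ?N * fact ?N = 2 * ?N * (2 ^ n * fact n)"
    by (simp add: algebra_simps)
  also have "\<dots> \<le> 2 * ?N * ?N ^ n"
    by (intro mult_left_mono Suc.IH) simp
  also have "\<dots> = 2 * ?N ^ ?N"
    by simp
  finally show ?case
    using bernoulli by (rule le_trans)
qed simp

lemma fact_le_power: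
  assumes "n < 2 * m"
  shows "fact n \<le> m ^ n"
proof -
  have "2 ^ n * fact n \<le> Suc n ^ n"
    by (rule two_power_mult_fact_le)
  also have "\<dots> \<le> (2 * m) ^ n"
    using assms by (intro power_mono) simp_all
  finally show ?thesis
    by (simp add: power_mult_distrib)
qed

lemma card_subsets_card_in:
  assumes "finite A" and "finite J"
  shows "card {S. S \<subseteq> A \<and> card S \<in> J} = (\<Sum>j\<in>J. card A choose j)"
proof -
  have "{S. S \<subseteq> A \<and> card S \<in> J} = (\<Union>j\<in>J. {S. S \<subseteq> A \<and> card S = j})"
    by auto
  moreover have "card (\<Union>j\<in>J. {S. S \<subseteq> A \<and> card S = j}) = (\<Sum>j\<in>J. card {S. S \<subseteq> A \<and> card S = j})"
    using assms by (intro card_UN_disjoint) auto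
  ultimately show ?thesis
    using assms by (simp add: n_subsets)
qed

abbreviation fibre :: "'a set \<Rightarrow> ('a \<Rightarrow> 'b) \<Rightarrow> 'b \<Rightarrow> 'a set" where
  "fibre A f b \<equiv> {a \<in> A. f a = b}"

lemma card_vimage_le_mult:
  assumes "finite T" and card_fibre: "\<And>b. b \<in> T \<Longrightarrow> card (fibre A f b) \<le> d"
  shows "card {a \<in> A. f a \<in> T} \<le> d * card T"
proof -
  have "{a \<in> A. f a \<in> T} = (\<Union>b\<in>T. fibre A f b)"
    by auto
  then have "card {a \<in> A. f a \<in> T} \<le> (\<Sum>b\<in>T. card (fibre A f b))"
    using card_UN_le[OF \<open>finite T\<close>] by simp
  also have "\<dots> \<le> d * card T"
    using sum_bounded_above[of T "\<lambda>b. card (fibre A f b)" d, OF card_fibre]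
    by (simp add: mult.commute)
  finally show ?thesis .
qed

lemma card_subsets_small_image_le:
  assumes "finite A" "finite B" "finite J" and image: "f ` A \<subseteq> B" and "K \<le> card B"
    and card_fibre: "\<And>b. b \<in> B \<Longrightarrow> card (fibre A f b) \<le> d"
  shows "card {S. S \<subseteq> A \<and> card S \<in> J \<and> card (f ` S) \<le> K}
    \<le> (card B choose K) * (\<Sum>j\<in>J. (d * K) choose j)"
proof -
  define supports where "supports = {T. T \<subseteq> B \<and> card T = K}"
  define over where "over T = {S. S \<subseteq> {a \<in> A. f a \<in> T} \<and> card S \<in> J}" for T
  have "finite supports"
    using \<open>finite B\<close> by (simp add: supports_def)
  have finite_over: "finite (over T)" for T
    using \<open>finite A\<close> by (simp add: over_def)
  have card_over: "card (over T) \<le> (\<Sum>j\<in>J. (d * K) choose j)" if "T \<in> supports" for T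
  proof -
    have "finite T" "card T = K" "T \<subseteq> B"
      using that finite_subset[OF _ \<open>finite B\<close>] by (auto simp: supports_def)
    then have "card {a \<in> A. f a \<in> T} \<le> d * K"
      using card_vimage_le_mult[of T A f d] card_fibre by blast
    then show ?thesis
      using \<open>finite A\<close> \<open>finite J\<close>
      by (simp add: over_def card_subsets_card_in sum_mono binomial_right_mono)
  qed
  have "{S. S \<subseteq> A \<and> card S \<in> J \<and> card (f ` S) \<le> K} \<subseteq> (\<Union>T\<in>supports. over T)"
  proof safe
    fix S assume small_image: "S \<subseteq> A" "card S \<in> J" "card (f ` S) \<le> K"
    then obtain T where "f ` S \<subseteq> T" "T \<subseteq> B" "card T = K"
      using exists_subset_between[of "f ` S" K B] \<open>K \<le> card B\<close> \<open>finite B\<close> image by blast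
    then show "S \<in> (\<Union>T\<in>supports. over T)"
      using small_image by (auto simp: supports_def over_def)
  qed
  then have "card {S. S \<subseteq> A \<and> card S \<in> J \<and> card (f ` S) \<le> K} \<le> card (\<Union>T\<in>supports. over T)"
    using \<open>finite supports\<close> finite_over by (intro card_mono) auto
  also have "\<dots> \<le> (\<Sum>T\<in>supports. card (over T))"
    using \<open>finite supports\<close> by (rule card_UN_le)
  also have "\<dots> \<le> card supports * (\<Sum>j\<in>J. (d * K) choose j)"
    using sum_bounded_above[of supports "\<lambda>T. card (over T)", OF card_over] by simp
  also have "card supports = card B choose K"
    using \<open>finite B\<close> by (simp add: supports_def n_subsets)
  finally show ?thesis .
qed

lemma card_subsets_small_image_two_to_one:
  assumes fin: "finite A" "finite B" "finite J" and image: "f ` A \<subseteq> B"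
    and card_fibre: "\<And>b. b \<in> B \<Longrightarrow> card (fibre A f b) \<le> 2"
    and large: "\<And>j. j \<in> J \<Longrightarrow> K < j"
  shows "card {S. S \<subseteq> A \<and> card S \<in> J \<and> card (f ` S) \<le> K} * fact K
    \<le> card B ^ K * (\<Sum>j\<in>J. (2 * K) choose j)"
    (is "card ?F * _ \<le> _ * ?s")
proof (cases "K \<le> card B")
  case True
  have "card ?F * fact K \<le> (card B choose K) * ?s * fact K"
    by (intro mult_right_mono card_subsets_small_image_le fin image True card_fibre) simp_all
  also have "\<dots> = (card B choose K) * fact K * ?s"
    by (simp only: mult_ac)
  also have "\<dots> \<le> card B ^ K * ?s"
    by (intro mult_right_mono binomial_fact_pow) simp
  finally show ?thesis .
next
  case False
  have "{a \<in> A. f a \<in> B} = A"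
    using image by auto
  then have card_A: "card A \<le> 2 * card B"
    using card_vimage_le_mult[of B A f 2] fin(2) card_fibre by simp
  have "card ?F \<le> card {S. S \<subseteq> A \<and> card S \<in> J}"
    using fin(1) by (intro card_mono) auto
  then have card_F: "card ?F \<le> (\<Sum>j\<in>J. card A choose j)"
    by (simp only: card_subsets_card_in fin(1,3))
  show ?thesis
  proof (cases "K < card A")
    case True
    then have "fact K \<le> card B ^ K"
      using card_A by (intro fact_le_power) simp
    moreover have "(\<Sum>j\<in>J. card A choose j) \<le> ?s"
      using False card_A by (intro sum_mono binomial_right_mono) simp
    ultimately show ?thesis
      using card_F mult_mono[of "card ?F" ?s "fact K" "card B ^ K"] by (simp add: mult.commute)
  next
    case False
    then have "(\<Sum>j\<in>J. card A choose j) = 0"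
      using large by (intro sum.neutral ballI binomial_eq_0) fastforce
    then show ?thesis
      using card_F by (simp only: le_zero_eq mult_0 zero_le)
  qed
qed

subsection \<open>Fibres of monotone functions\<close>

lemma interval_in_fibre:
  fixes f :: "'a::linorder \<Rightarrow> 'b::order"
  assumes "mono_on V f"
  shows "interval_in V (fibre V f q)"
  unfolding interval_in_def using assms by (auto intro!: order.antisym dest: mono_onD)

lemma set_before_fibres:
  fixes f :: "'a::linorder \<Rightarrow> 'b::order"
  assumes "mono_on V f" and "p < q"
  shows "set_before (fibre V f p) (fibre V f q)"
  unfolding set_before_def
proof safe
  fix x y assume "x \<in> V" "y \<in> V" "p = f x" "q = f y"
  then show "x < y"
    using assms mono_onD[of V f y x] by (meson leD not_le_imp_less)
qed

lemma interval_parts_fibres: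
  fixes f :: "'a::linorder \<Rightarrow> 'b::order"
  assumes mono: "mono_on V f" and strict: "strict_mono_on {1..l} h"
    and edge_subset: "\<And>e. e \<in> G \<Longrightarrow> e \<subseteq> V"
    and edge_image: "\<And>e. e \<in> G \<Longrightarrow> f ` e = h ` {1..l}"
  shows "interval_parts V G l (\<lambda>j. fibre V f (h j))"
  unfolding interval_parts_def
proof (intro conjI ballI impI)
  fix i j assume "i \<in> {1..l}" "j \<in> {1..l}" "i < j"
  then show "set_before (fibre V f (h i)) (fibre V f (h j))"
    using set_before_fibres[OF mono] strict_mono_onD[OF strict] by blast
next
  fix e assume "e \<in> G"
  show "e \<subseteq> (\<Union>j\<in>{1..l}. fibre V f (h j))"
  proof
    fix x assume "x \<in> e"
    then have "f x \<in> h ` {1..l}" "x \<in> V"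
      using edge_subset[OF \<open>e \<in> G\<close>] edge_image[OF \<open>e \<in> G\<close>] by blast+
    then show "x \<in> (\<Union>j\<in>{1..l}. fibre V f (h j))"
      by auto
  qed
  fix j assume "j \<in> {1..l}"
  then have "h j \<in> f ` e"
    using edge_image[OF \<open>e \<in> G\<close>] by blast
  then show "e \<inter> fibre V f (h j) \<noteq> {}"
    using edge_subset[OF \<open>e \<in> G\<close>] by auto
qed (rule interval_in_fibre[OF mono])

lemma finite_strict_mono_enumeration:
  fixes S :: "'b::linorder set"
  assumes "finite S"
  obtains h where "strict_mono_on {1..card S} h" and "h ` {1..card S} = S"
proof
  let ?xs = "sorted_list_of_set S" and ?h = "\<lambda>j. sorted_list_of_set S ! (j - 1)"
  show "strict_mono_on {1..card S} ?h"
    using sorted_wrt_nth_less[OF strict_sorted_list_of_set, of _ _ S]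
    by (intro strict_mono_onI) auto
  have "?h ` Suc ` {..<card S} = nth ?xs ` {0..<card S}"
    by (simp only: image_image diff_Suc_1 lessThan_atLeast0)
  also have "\<dots> = S"
    using assms by (simp add: nth_image)
  finally show "?h ` {1..card S} = S"
    by (simp only: image_Suc_lessThan)
qed

lemma interval_partite_fibres:
  fixes f :: "'a::linorder \<Rightarrow> 'b::linorder"
  assumes graph: "ordered_rgraph r V G" and edge_image: "\<And>e. e \<in> G \<Longrightarrow> f ` e = S"
    and "finite S" and "k \<le> card S" and mono: "mono_on V f"
    and card_fibre: "\<And>q. int (card (fibre V f q)) \<le> s"
  shows "interval_partite_parts_le r k s V G"
proof -
  obtain h where "strict_mono_on {1..card S} h" "h ` {1..card S} = S"
    using finite_strict_mono_enumeration[OF \<open>finite S\<close>] .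
  then have "interval_parts V G (card S) (\<lambda>j. fibre V f (h j))"
    using graph edge_image by (intro interval_parts_fibres mono) (auto simp: ordered_rgraph_def)
  then show ?thesis
    unfolding interval_partite_parts_le_def using graph \<open>k \<le> card S\<close> card_fibre by blast
qed

lemma interval_partite_parts_le_mono:
  assumes "interval_partite_parts_le r k s V G" and "s \<le> t"
  shows "interval_partite_parts_le r k t V G"
  using assms unfolding interval_partite_parts_le_def by (meson order_trans)

subsection \<open>Equitable division of a finite ordered set into blocks\<close>

definition rank_in :: "'a::linorder set \<Rightarrow> 'a \<Rightarrow> nat" where
  "rank_in V x = card {v \<in> V. v < x}"

definition block_index :: "'a::linorder set \<Rightarrow> nat \<Rightarrow> 'a \<Rightarrow> nat" where
  "block_index V m x = rank_in V x * m div card V"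

definition blocks_met :: "'a::linorder set \<Rightarrow> nat \<Rightarrow> 'a set \<Rightarrow> nat set" where
  "blocks_met V m e = block_index V m ` e"

lemma mono_rank_in: "finite V \<Longrightarrow> mono (rank_in V)"
  unfolding rank_in_def by (intro monoI card_mono) auto

lemma strict_mono_on_rank_in: "finite V \<Longrightarrow> strict_mono_on V (rank_in V)"
  unfolding rank_in_def by (intro strict_mono_onI psubset_card_mono) auto

lemma rank_in_less_card: "finite V \<Longrightarrow> x \<in> V \<Longrightarrow> rank_in V x < card V"
  unfolding rank_in_def by (intro psubset_card_mono) auto

lemma mono_block_index: "finite V \<Longrightarrow> mono (block_index V m)"
  unfolding block_index_def
  by (intro monoI div_le_mono mult_right_mono monoD[OF mono_rank_in]) auto

lemma block_index_less: "finite V \<Longrightarrow> x \<in> V \<Longrightarrow> 0 < m \<Longrightarrow> block_index V m x < m"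
  unfolding block_index_def using rank_in_less_card[of V x]
  by (simp add: div_less_iff_less_mult mult.commute)

lemma block_index_refine: "0 < d \<Longrightarrow> block_index V (d * m) x div d = block_index V m x"
  unfolding block_index_def
  by (simp add: mult.left_commute flip: div_mult2_eq)

lemma strict_mono_on_block_index:
  assumes "finite V" and "card V \<le> m"
  shows "strict_mono_on V (block_index V m)"
proof (rule strict_mono_onI)
  fix x y assume in_V: "x \<in> V" "y \<in> V" and "x < y"
  then have "Suc (rank_in V x) \<le> rank_in V y"
    using strict_mono_onD[OF strict_mono_on_rank_in[OF \<open>finite V\<close>]] by (simp add: Suc_leI)
  then have "Suc (rank_in V x) * m \<le> rank_in V y * m"
    by (rule mult_right_mono) simp
  then have "rank_in V x * m + card V \<le> rank_in V y * m"
    using \<open>card V \<le> m\<close> by simp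
  then have "(rank_in V x * m + card V) div card V \<le> block_index V m y"
    unfolding block_index_def by (rule div_le_mono)
  moreover have "0 < card V"
    using in_V \<open>finite V\<close> by (auto simp: card_gt_0_iff)
  ultimately show "block_index V m x < block_index V m y"
    by (simp add: block_index_def)
qed

lemma card_block_le:
  assumes "finite V" and "0 < m"
  shows "int (card (fibre V (block_index V m) q)) \<le> \<lceil>real (card V) / real m\<rceil>"
proof -
  let ?B = "fibre V (block_index V m) q" and ?w = "real (card V) / real m"
  have inj: "inj_on (\<lambda>x. int (rank_in V x)) ?B"
    using strict_mono_on_imp_inj_on[OF strict_mono_on_rank_in[OF \<open>finite V\<close>]]
    by (auto simp: inj_on_def)
  have "int (rank_in V x) \<in> {\<lceil>real q * ?w\<rceil>..<\<lceil>real q * ?w + ?w\<rceil>}" if "x \<in> ?B" for x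
  proof -
    have "rank_in V x * m div card V = q" and "0 < card V"
      using that \<open>finite V\<close> by (auto simp: block_index_def card_gt_0_iff)
    then have "q * card V \<le> rank_in V x * m" "rank_in V x * m < Suc q * card V"
      using less_eq_div_iff_mult_less_eq[of "card V" q] div_less_iff_less_mult[of "card V" _ "Suc q"]
      by auto
    then have "real (q * card V) \<le> real (rank_in V x * m)"
      "real (rank_in V x * m) < real (Suc q * card V)"
      by (simp_all only: of_nat_le_iff of_nat_less_iff)
    then have "real q * ?w \<le> real (rank_in V x)" "real (rank_in V x) < real q * ?w + ?w"
      using \<open>0 < m\<close> by (simp_all add: field_simps)
    then show ?thesis
      by (simp add: ceiling_le_iff less_ceiling_iff)
  qed
  then have "card ?B \<le> card {\<lceil>real q * ?w\<rceil>..<\<lceil>real q * ?w + ?w\<rceil>}"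
    by (intro card_inj_on_le[OF inj]) auto
  then have "int (card ?B) \<le> max 0 (\<lceil>real q * ?w + ?w\<rceil> - \<lceil>real q * ?w\<rceil>)"
    by simp
  also have "\<dots> \<le> \<lceil>?w\<rceil>"
    using ceiling_add_le[of "real q * ?w" ?w] by (simp add: less_le_trans[of "-1" 0])
  finally show ?thesis .
qed

lemma card_blocks_met_fine:
  assumes "finite V" "card V \<le> m" "e \<subseteq> V"
  shows "card (blocks_met V m e) = card e"
  unfolding blocks_met_def
  using strict_mono_on_block_index[OF assms(1,2)] assms(3)
  by (intro card_image inj_on_subset[OF strict_mono_on_imp_inj_on])

lemma card_blocks_met_one:
  assumes "finite V" "e \<subseteq> V"
  shows "card (blocks_met V 1 e) \<le> 1"
proof -
  have "blocks_met V 1 e \<subseteq> {0}"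
    using assms block_index_less[of V _ 1] by (auto simp: blocks_met_def)
  then show ?thesis
    using card_mono[of "{0}" "blocks_met V 1 e"] by simp
qed

lemma blocks_met_subset:
  assumes "finite V" "e \<subseteq> V" "0 < m"
  shows "blocks_met V m e \<subseteq> {..<m}"
  using assms block_index_less[of V _ m] by (auto simp: blocks_met_def)

lemma blocks_met_refine: "0 < d \<Longrightarrow> (\<lambda>q. q div d) ` blocks_met V (d * m) e = blocks_met V m e"
  by (simp add: blocks_met_def image_image block_index_refine)

lemma interval_partite_blocks_met:
  assumes graph: "ordered_rgraph r V G" and "\<And>e. e \<in> G \<Longrightarrow> blocks_met V m e = S"
    and "finite S" "k \<le> card S" "0 < m"
  shows "interval_partite_parts_le r k \<lceil>real (card V) / real m\<rceil> V G"
proof -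
  have "finite V"
    using graph by (simp add: ordered_rgraph_def)
  show ?thesis
  proof (rule interval_partite_fibres)
    show "mono_on V (block_index V m)"
      using mono_block_index[OF \<open>finite V\<close>] by (rule mono_imp_mono_on)
    show "int (card (fibre V (block_index V m) q)) \<le> \<lceil>real (card V) / real m\<rceil>" for q
      using \<open>finite V\<close> \<open>0 < m\<close> by (rule card_block_le)
  qed (use assms in \<open>simp_all add: blocks_met_def\<close>)
qed

subsection \<open>The level at which an edge spreads over many blocks\<close>

definition split_level :: "'a::linorder set \<Rightarrow> nat \<Rightarrow> 'a set \<Rightarrow> nat" where
  "split_level V k e = (LEAST i. k \<le> card (blocks_met V (2 ^ Suc i) e))"

lemma split_level_le:
  assumes "finite V" "e \<subseteq> V" "k \<le> card e" "card V \<le> 2 ^ Suc L"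
  shows "split_level V k e \<le> L"
  unfolding split_level_def using assms by (intro Least_le) (simp only: card_blocks_met_fine)

lemma card_blocks_met_split_level_ge:
  assumes "finite V" "e \<subseteq> V" "k \<le> card e"
  shows "k \<le> card (blocks_met V (2 ^ Suc (split_level V k e)) e)"
  unfolding split_level_def
proof (rule LeastI)
  have "card V \<le> 2 ^ Suc (card V)"
    using less_exp[of "Suc (card V)"] by linarith
  then show "k \<le> card (blocks_met V (2 ^ Suc (card V)) e)"
    using assms by (simp only: card_blocks_met_fine)
qed

lemma card_blocks_met_split_level_less:
  assumes "finite V" "e \<subseteq> V" "2 \<le> k"
  shows "card (blocks_met V (2 ^ split_level V k e) e) < k"
proof (cases "split_level V k e")
  case 0
  then show ?thesis
    using card_blocks_met_one[of V e] assms by simp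
next
  case (Suc i)
  then have "\<not> k \<le> card (blocks_met V (2 ^ Suc i) e)"
    unfolding split_level_def by (intro not_less_Least) simp
  then show ?thesis
    using Suc by simp
qed

definition split_patterns :: "nat \<Rightarrow> nat \<Rightarrow> nat \<Rightarrow> nat set set" where
  "split_patterns k r m = {S. S \<subseteq> {..<2 * m} \<and> card S \<in> {k..r} \<and> card ((\<lambda>q. q div 2) ` S) < k}"

lemma finite_split_patterns: "finite (split_patterns k r m)"
  by (simp add: split_patterns_def)

lemma card_split_patterns_le:
  assumes "0 < k"
  shows "real (card (split_patterns k r m))
    \<le> 1 / fact (k - 1) * (\<Sum>j=k..r. real ((2 * k - 2) choose j)) * real (m ^ (k - 1))"
proof -
  have card_fibre: "card (fibre {..<2 * m} (\<lambda>q. q div 2) t) \<le> 2" for t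
    using card_mono[of "{2 * t, Suc (2 * t)}" "fibre {..<2 * m} (\<lambda>q. q div 2) t"] by fastforce
  have "split_patterns k r m
    = {S. S \<subseteq> {..<2 * m} \<and> card S \<in> {k..r} \<and> card ((\<lambda>q. q div 2) ` S) \<le> k - 1}"
    using assms by (auto simp: split_patterns_def)
  then have "card (split_patterns k r m) * fact (k - 1)
    \<le> card {..<m} ^ (k - 1) * (\<Sum>j=k..r. (2 * (k - 1)) choose j)"
    using assms card_fibre by (simp only:) (rule card_subsets_small_image_two_to_one; auto)
  then have "real (card (split_patterns k r m) * fact (k - 1))
    \<le> real (m ^ (k - 1) * (\<Sum>j=k..r. (2 * k - 2) choose j))"
    by (simp only: of_nat_le_iff card_lessThan diff_mult_distrib2 mult_1_right)
  then show ?thesis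
    by (simp add: field_simps)
qed

lemma blocks_met_in_split_patterns:
  assumes "finite V" "e \<subseteq> V" "2 \<le> k" "k \<le> card e"
  shows "blocks_met V (2 ^ Suc (split_level V k e)) e
    \<in> split_patterns k (card e) (2 ^ split_level V k e)"
proof -
  let ?i = "split_level V k e"
  have "blocks_met V (2 ^ Suc ?i) e \<subseteq> {..<2 ^ Suc ?i}"
    using assms by (intro blocks_met_subset) simp_all
  moreover have "card (blocks_met V (2 ^ Suc ?i) e) \<in> {k..card e}"
    using card_blocks_met_split_level_ge[of V e k] card_image_le[of e] assms
    by (auto simp: blocks_met_def intro: finite_subset)
  moreover have "card ((\<lambda>q. q div 2) ` blocks_met V (2 ^ Suc ?i) e) < k"
    using card_blocks_met_split_level_less[of V e k] assms by (simp add: blocks_met_refine)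
  ultimately show ?thesis
    by (simp add: split_patterns_def)
qed

lemma split_level_fibre_covering:
  assumes graph: "ordered_rgraph r V H" and "2 \<le> k" and "k \<le> r"
  shows "\<exists>F. finite F \<and> fibre H (split_level V k) i = \<Union>F \<and>
    real (card F) \<le> 1 / fact (k - 1) * (\<Sum>j=k..r. real ((2 * k - 2) choose j)) * 2 ^ (i * (k - 1)) \<and>
    (\<forall>G\<in>F. interval_partite_parts_le r k \<lceil>real (card V) / 2 ^ i\<rceil> V G)"
proof -
  let ?P = "split_patterns k r (2 ^ i)"
  let ?part = "fibre (fibre H (split_level V k) i) (blocks_met V (2 ^ Suc i))"
  have "blocks_met V (2 ^ Suc i) e \<in> ?P" if "e \<in> fibre H (split_level V k) i" for e
    using blocks_met_in_split_patterns[of V e k] that assms by (auto simp: ordered_rgraph_def)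
  then have "fibre H (split_level V k) i = \<Union>(?part ` ?P)"
    by auto
  moreover have "interval_partite_parts_le r k \<lceil>real (card V) / 2 ^ i\<rceil> V (?part S)"
    if "S \<in> ?P" for S
  proof -
    have "interval_partite_parts_le r k \<lceil>real (card V) / real (2 ^ Suc i)\<rceil> V (?part S)"
    proof (rule interval_partite_blocks_met)
      show "ordered_rgraph r V (?part S)"
        using graph by (auto simp: ordered_rgraph_def)
      show "finite S" "k \<le> card S"
        using that finite_subset by (auto simp: split_patterns_def)
    qed simp_all
    moreover have "\<lceil>real (card V) / real (2 ^ Suc i)\<rceil> \<le> \<lceil>real (card V) / 2 ^ i\<rceil>"
      by (intro ceiling_mono) (simp add: field_simps)
    ultimately show ?thesis
      by (rule interval_partite_parts_le_mono)
  qed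
  moreover have "real (card (?part ` ?P))
    \<le> 1 / fact (k - 1) * (\<Sum>j=k..r. real ((2 * k - 2) choose j)) * 2 ^ (i * (k - 1))"
  proof -
    have "real (card (?part ` ?P)) \<le> real (card ?P)"
      by (intro of_nat_mono card_image_le finite_split_patterns)
    also note card_split_patterns_le[of k r "2 ^ i"]
    finally show ?thesis
      using \<open>2 \<le> k\<close> by (simp add: power_mult)
  qed
  ultimately show ?thesis
    using finite_split_patterns by (intro exI[of _ "?part ` ?P"]) blast
qed

theorem theorem1p1:
  fixes k r n :: nat and V :: "'a::linorder set" and H :: "'a set set"
  assumes "2 \<le> k" and "k \<le> r" and "r \<le> n"
    and "ordered_rgraph r V H" and "card V = n"
  shows "\<exists>Hs :: nat \<Rightarrow> 'a set set.
    H = (\<Union>i\<in>{0..nat \<lfloor>log 2 (real n)\<rfloor>}. Hs i) \<and>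
    disjoint_family_on Hs {0..nat \<lfloor>log 2 (real n)\<rfloor>} \<and>
    (\<forall>i\<in>{0..nat \<lfloor>log 2 (real n)\<rfloor>}.
       \<exists>F :: 'a set set set.
         finite F \<and> Hs i = \<Union>F \<and>
         real (card F) \<le> 1 / fact (k - 1) * (\<Sum>j=k..r. real ((2 * k - 2) choose j)) * 2 ^ (i * (k - 1)) \<and>
         (\<forall>G\<in>F. interval_partite_parts_le r k \<lceil>real n / 2 ^ i\<rceil> V G))"
proof -
  define L where "L = nat \<lfloor>log 2 (real n)\<rfloor>"
  have graph: "finite V" "\<And>e. e \<in> H \<Longrightarrow> e \<subseteq> V \<and> k \<le> card e"
    using assms(2,4) by (auto simp: ordered_rgraph_def)
  have "card V \<le> 2 ^ Suc L"
    using floorlog_bounds[of n 2] assms(1-3,5) by (simp add: floorlog_def L_def)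
  then have "H = (\<Union>i\<in>{0..L}. fibre H (split_level V k) i)"
    using graph split_level_le[of V _ k L] by auto
  moreover have "disjoint_family_on (fibre H (split_level V k)) {0..L}"
    by (auto simp: disjoint_family_on_def)
  ultimately show ?thesis
    using split_level_fibre_covering[OF assms(4,1,2)] assms(5) unfolding L_def by blast
qed

end
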